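(* Let $H$ be an $s$-uniform hypergraph on an $n$-element vertex set $V$, where $1\le s\le n$, and suppose that $e(H)\ge\delta\binom{n}{s}$. Then there exist maps $$f:\mathcal{I}(H)\longrightarrow\bigcup_{j=0}^{s-1}V_{\neq}^{j},\qquad C:\operatorname{im}(f)\longrightarrow\binom{V}{\le(1-\delta/s)n},$$ such that every entry of $f(I)$ belongs to $I$ and $I\subseteq C(f(I))$ for every independent set $I\in\mathcal{I}(H)$.
   Context: $e(H)$ is the number of hyperedges of $H$. $\mathcal{I}(H)$ is the family of independent sets of $H$, i.e. subsets of $V$ containing no hyperedge of $H$. $V_{\neq}^{j}$ denotes the family of ordered $j$-tuples of distinct elements of $V$ (for $j=0$ it consists of the empty tuple). $\binom{V}{\le x}$ denotes the family of subsets of $V$ of size at most $x$. *)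

theory Defs
  imports Complex_Main "HOL-Library.FuncSet"
begin

text \<open>A hypergraph is given by its vertex set \<open>V\<close> and its set \<open>E\<close> of hyperedges.\<close>

definition uniform_hypergraph :: "nat \<Rightarrow> 'a set \<Rightarrow> 'a set set \<Rightarrow> bool" where
  "uniform_hypergraph s V E \<longleftrightarrow> finite V \<and> (\<forall>e\<in>E. e \<subseteq> V \<and> card e = s)"

definition independent_sets :: "'a set \<Rightarrow> 'a set set \<Rightarrow> 'a set set" where
  "independent_sets V E = {I. I \<subseteq> V \<and> (\<forall>e\<in>E. \<not> e \<subseteq> I)}"

text \<open>Ordered tuples are represented by lists.\<close>

definition distinct_tuples :: "'a set \<Rightarrow> nat \<Rightarrow> 'a list set" where
  "distinct_tuples V j = {xs. length xs = j \<and> distinct xs \<and> set xs \<subseteq> V}"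

text \<open>The size bound is real and need not be an integer.\<close>

definition subsets_of_size_le :: "'a set \<Rightarrow> real \<Rightarrow> 'a set set" where
  "subsets_of_size_le V x = {A. A \<subseteq> V \<and> real (card A) \<le> x}"

end

theory Submission
  imports Defs
begin

text \<open>
  The maps come from a decision procedure that queries an independent set one vertex at a time.
  Fix a vertex \<open>v\<close> of at least average degree and let \<open>s\<close> and \<open>n\<close> be the uniformity and
  the number of vertices.

  If \<open>v \<in> I\<close>, record \<open>v\<close> in the fingerprint and continue with \<open>I - {v}\<close>, which is independent in
  the link of \<open>v\<close>. The link is \<open>(s - 1)\<close>-uniform, and its density is at least \<open>\<delta>\<close> because \<open>v\<close> has
  at least average degree. Since \<open>(n - 1) / (s - 1) \<ge> n / s\<close>, the number
  \<open>\<delta> (n - 1) / (s - 1)\<close> of vertices that are excluded later is large enough. Each record lowers the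
  uniformity, and a \<open>1\<close>-uniform hypergraph needs no query: its edges are singletons that \<open>I\<close>
  avoids. So at most \<open>s - 1\<close> vertices are recorded.

  If \<open>v \<notin> I\<close>, record nothing, exclude \<open>v\<close> from the container, and continue with \<open>H - v\<close>. The density may
  drop, but the potential ``\<open>s\<close> times the number of excluded vertices, plus density times
  the number of remaining vertices'' does not: as \<open>v\<close> lies in at most \<open>(n - 1) choose (s - 1)\<close> edges,
  the density of \<open>H - v\<close> is at least \<open>(\<delta> n - s) / (n - 1)\<close> if \<open>\<delta> n > s\<close>, and if \<open>\<delta> n \<le> s\<close> then
  the exclusion of \<open>v\<close> alone is enough.

  The second branch records only vertices other than \<open>v\<close>, so the fingerprint tells
  which branch was taken, and with it the container can be recovered. The lemma \<open>container_scheme_branch\<close> glues the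
  two branches, and \<open>container_scheme_independent_sets\<close> is the induction on the number of vertices.
\<close>

section \<open>Fingerprints and containers\<close>

text \<open>
  The family \<open>F\<close> is kept arbitrary, so that it can be split according to whether a
  given vertex belongs to its members.
\<close>

definition container_scheme :: "'a set \<Rightarrow> 'a set set \<Rightarrow> nat \<Rightarrow> real \<Rightarrow> bool" where
  "container_scheme V F k b \<longleftrightarrow> (\<exists>f C. \<forall>I\<in>F.
     distinct (f I) \<and> length (f I) \<le> k \<and> set (f I) \<subseteq> I \<and>
     I \<subseteq> C (f I) \<and> C (f I) \<subseteq> V \<and> real (card (C (f I))) \<le> b)"

lemma container_scheme_mono:
  assumes "container_scheme V F k b" and "F' \<subseteq> F" and "b \<le> b'"
  shows "container_scheme V F' k b'"
proof -
  obtain f C where "\<forall>I\<in>F. distinct (f I) \<and> length (f I) \<le> k \<and> set (f I) \<subseteq> I \<and>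
      I \<subseteq> C (f I) \<and> C (f I) \<subseteq> V \<and> real (card (C (f I))) \<le> b"
    using assms(1) unfolding container_scheme_def by (elim exE)
  with assms(2,3) show ?thesis
    unfolding container_scheme_def by (intro exI[of _ f] exI[of _ C]) fastforce
qed

lemma container_scheme_single:
  assumes "\<And>I. I \<in> F \<Longrightarrow> I \<subseteq> A" and "A \<subseteq> V" and "real (card A) \<le> b"
  shows "container_scheme V F k b"
  unfolding container_scheme_def
  by (rule exI[of _ "\<lambda>_. []"], rule exI[of _ "\<lambda>_. A"]) (use assms in auto)

text \<open>
  The two fingerprint maps can be merged without collisions because those of the first scheme
  are subsets of sets that avoid \<open>v\<close>: a fingerprint contains \<open>v\<close> exactly if the set does. In the
  branch \<open>v \<in> I\<close> the vertex \<open>v\<close> returns to the container, which costs the \<open>1\<close> in the bound there.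
\<close>

lemma container_scheme_branch:
  assumes "finite V" and "v \<in> V"
    and out: "container_scheme (V - {v}) {I \<in> F. v \<notin> I} (Suc k) b"
    and inn: "container_scheme (V - {v}) ((\<lambda>I. I - {v}) ` {I \<in> F. v \<in> I}) k (b - 1)"
  shows "container_scheme V F (Suc k) b"
proof -
  obtain f0 C0 where f0: "\<forall>I\<in>{I \<in> F. v \<notin> I}.
      distinct (f0 I) \<and> length (f0 I) \<le> Suc k \<and> set (f0 I) \<subseteq> I \<and>
      I \<subseteq> C0 (f0 I) \<and> C0 (f0 I) \<subseteq> V - {v} \<and> real (card (C0 (f0 I))) \<le> b"
    using out unfolding container_scheme_def by (elim exE)
  obtain f1 C1 where f1: "\<forall>J\<in>(\<lambda>I. I - {v}) ` {I \<in> F. v \<in> I}.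
      distinct (f1 J) \<and> length (f1 J) \<le> k \<and> set (f1 J) \<subseteq> J \<and>
      J \<subseteq> C1 (f1 J) \<and> C1 (f1 J) \<subseteq> V - {v} \<and> real (card (C1 (f1 J))) \<le> b - 1"
    using inn unfolding container_scheme_def by (elim exE)
  define f where "f I = (if v \<in> I then v # f1 (I - {v}) else f0 I)" for I
  define C where "C xs = (if v \<in> set xs then insert v (C1 (tl xs)) else C0 xs)" for xs
  have "distinct (f I) \<and> length (f I) \<le> Suc k \<and> set (f I) \<subseteq> I \<and>
      I \<subseteq> C (f I) \<and> C (f I) \<subseteq> V \<and> real (card (C (f I))) \<le> b" if I: "I \<in> F" for I
  proof (cases "v \<in> I")
    case True
    then have 1: "I - {v} \<in> (\<lambda>I. I - {v}) ` {I \<in> F. v \<in> I}" using I by blast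
    have "finite (C1 (f1 (I - {v})))" and "v \<notin> C1 (f1 (I - {v}))"
      using bspec[OF f1 1] \<open>finite V\<close> finite_subset by blast+
    then show ?thesis using bspec[OF f1 1] True \<open>v \<in> V\<close> by (auto simp: f_def C_def)
  next
    case False
    then have 0: "I \<in> {I \<in> F. v \<notin> I}" using I by blast
    have "v \<notin> set (f0 I)" using bspec[OF f0 0] False by blast
    then show ?thesis using bspec[OF f0 0] False by (auto simp: f_def C_def)
  qed
  then show ?thesis unfolding container_scheme_def by blast
qed

section \<open>Links and vertex deletion\<close>

definition link :: "'a \<Rightarrow> 'a set set \<Rightarrow> 'a set set" where
  "link v E = (\<lambda>e. e - {v}) ` {e \<in> E. v \<in> e}"

definition delete_vertex :: "'a \<Rightarrow> 'a set set \<Rightarrow> 'a set set" where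
  "delete_vertex v E = {e \<in> E. v \<notin> e}"

lemma uniform_hypergraph_finite_edges:
  assumes "uniform_hypergraph s V E"
  shows "finite E"
proof (rule finite_subset)
  show "E \<subseteq> Pow V" and "finite (Pow V)"
    using assms by (auto simp: uniform_hypergraph_def)
qed

lemma card_uniform_hypergraph_le:
  assumes "uniform_hypergraph s V E"
  shows "card E \<le> card V choose s"
proof -
  have "E \<subseteq> {A. A \<subseteq> V \<and> card A = s}" and "finite V"
    using assms by (auto simp: uniform_hypergraph_def)
  moreover have "finite {A. A \<subseteq> V \<and> card A = s}"
    using \<open>finite V\<close> by simp
  ultimately have "card E \<le> card {A. A \<subseteq> V \<and> card A = s}" by (intro card_mono)
  then show ?thesis using n_subsets[OF \<open>finite V\<close>, of s] by simp
qed

lemma uniform_hypergraph_link: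
  assumes "uniform_hypergraph (Suc k) V E"
  shows "uniform_hypergraph k (V - {v}) (link v E)"
  using assms unfolding uniform_hypergraph_def link_def
  by (auto dest: finite_subset simp: card_Diff_singleton)

lemma uniform_hypergraph_delete_vertex:
  assumes "uniform_hypergraph s V E"
  shows "uniform_hypergraph s (V - {v}) (delete_vertex v E)"
  using assms unfolding uniform_hypergraph_def delete_vertex_def by auto

lemma card_link: "card (link v E) = card {e \<in> E. v \<in> e}"
  unfolding link_def by (rule card_image) (auto simp: inj_on_def)

lemma card_link_plus_card_delete_vertex:
  assumes "finite E"
  shows "card (link v E) + card (delete_vertex v E) = card E"
proof -
  have "card ({e \<in> E. v \<in> e} \<union> {e \<in> E. v \<notin> e})
      = card {e \<in> E. v \<in> e} + card {e \<in> E. v \<notin> e}"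
    using assms by (intro card_Un_disjoint) auto
  moreover have "{e \<in> E. v \<in> e} \<union> {e \<in> E. v \<notin> e} = E" by auto
  ultimately show ?thesis by (simp add: card_link delete_vertex_def)
qed

lemma independent_sets_delete_vertex:
  "{I \<in> independent_sets V E. v \<notin> I} \<subseteq> independent_sets (V - {v}) (delete_vertex v E)"
  unfolding independent_sets_def delete_vertex_def by auto

lemma independent_sets_link:
  "(\<lambda>I. I - {v}) ` {I \<in> independent_sets V E. v \<in> I} \<subseteq> independent_sets (V - {v}) (link v E)"
  unfolding independent_sets_def link_def by fastforce

lemma exists_vertex_of_average_degree:
  assumes "uniform_hypergraph s V E" and "V \<noteq> {}"
  obtains v where "v \<in> V" and "s * card E \<le> card V * card (link v E)"
proof -
  have fin: "finite V" "finite E" and edge: "\<And>e. e \<in> E \<Longrightarrow> e \<subseteq> V \<and> card e = s"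
    using assms uniform_hypergraph_finite_edges by (auto simp: uniform_hypergraph_def)
  have "(\<Sum>v\<in>V. card (link v E)) = (\<Sum>v\<in>V. card {e \<in> E. v \<in> e})"
    by (simp add: card_link)
  also have "\<dots> = s * card E"
  proof (rule sum_multicount[OF fin])
    show "\<forall>e\<in>E. card {v \<in> V. v \<in> e} = s"
    proof
      fix e assume "e \<in> E"
      then have "{v \<in> V. v \<in> e} = e" using edge by auto
      then show "card {v \<in> V. v \<in> e} = s" using edge \<open>e \<in> E\<close> by simp
    qed
  qed
  finally have total: "(\<Sum>v\<in>V. card (link v E)) = s * card E" .
  show thesis
  proof (rule ccontr)
    assume "\<not> thesis"
    then have "card V * card (link v E) < s * card E" if "v \<in> V" for v
      using that \<open>\<And>v. _ \<Longrightarrow> _ \<Longrightarrow> thesis\<close> by (meson not_le)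
    then have "(\<Sum>v\<in>V. card V * card (link v E)) < (\<Sum>v\<in>V. s * card E)"
      using fin \<open>V \<noteq> {}\<close> by (intro sum_strict_mono) auto
    then show False by (simp add: total flip: sum_distrib_left)
  qed
qed

section \<open>Density bounds\<close>

text \<open>
  Both \<open>E\<close> and the complete hypergraph satisfy ``average degree = \<open>s / n\<close> times the number of edges'',
  so passing to a link of at least average degree preserves a lower bound on the density.
\<close>

lemma link_density:
  fixes \<delta> :: real
  assumes "card V = Suc m"
    and "Suc k * card E \<le> card V * card (link v E)"
    and "\<delta> * real (Suc m choose Suc k) \<le> real (card E)"
  shows "\<delta> * real (m choose k) \<le> real (card (link v E))"
proof -
  have "real (Suc m) * (\<delta> * real (m choose k)) = \<delta> * real (Suc m * (m choose k))"
    by (simp add: algebra_simps)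
  also have "\<dots> = real (Suc k) * (\<delta> * real (Suc m choose Suc k))"
    by (simp only: Suc_times_binomial_eq of_nat_mult) simp
  also have "\<dots> \<le> real (Suc k) * real (card E)"
    using assms(3) by (intro mult_left_mono) auto
  also have "\<dots> \<le> real (Suc m) * real (card (link v E))"
    using assms(1,2) by (metis of_nat_le_iff of_nat_mult)
  finally show ?thesis by simp
qed

text \<open>
  With \<open>n = m + 1\<close> and \<open>s = k + 1\<close> this is the monotonicity of the potential. Both
  \<open>n choose s\<close> and the maximal degree \<open>m choose k\<close> are multiples of \<open>m choose s\<close>, by the factors
  \<open>n / (n - s)\<close> and \<open>s / (n - s)\<close>; this leaves density at least \<open>(\<delta> n - s) / (n - s)\<close>, and enlarging
  the denominator to \<open>n - 1\<close> only decreases the quotient.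
\<close>

lemma delete_vertex_density:
  fixes \<delta> :: real
  assumes H: "uniform_hypergraph (Suc k) V E" and "v \<in> V" and m: "card V = Suc m" and "k < m"
    and dense: "\<delta> * real (Suc m choose Suc k) \<le> real (card E)"
    and large: "real (Suc k) \<le> \<delta> * real (Suc m)"
  shows "(\<delta> * real (Suc m) - real (Suc k)) / real m * real (m choose Suc k)
    \<le> real (card (delete_vertex v E))"
proof -
  define B where "B = real (m choose Suc k)"
  define x where "x = \<delta> * real (Suc m) - real (Suc k)"
  have mk: "real m - real k > 0" using \<open>k < m\<close> by simp
  have b: "(real m - real k) * real (m choose k) = real (Suc k) * B"
  proof -
    have "Suc k * (m choose Suc k) = (m choose k) * (m - k)"
      using binomial_absorption[of k m] binomial_absorb_comp[of m k] by (simp add: mult.commute)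
    then have "real (Suc k * (m choose Suc k)) = real ((m choose k) * (m - k))"
      by (rule arg_cong)
    then show ?thesis using \<open>k < m\<close> by (simp add: B_def of_nat_diff algebra_simps)
  qed
  have bn: "real (Suc m choose Suc k) = real (m choose k) + B"
    by (simp add: B_def)
  have "(real m - real k) * (\<delta> * real (Suc m choose Suc k) - real (m choose k))
      = \<delta> * ((real m - real k) * real (m choose k) + (real m - real k) * B)
        - (real m - real k) * real (m choose k)"
    unfolding bn by (simp add: algebra_simps)
  also have "\<dots> = x * B"
    unfolding b by (simp add: x_def algebra_simps)
  finally have key: "x * B = (real m - real k) * (\<delta> * real (Suc m choose Suc k) - real (m choose k))"
    by simp
  have "x / real m * B \<le> x / (real m - real k) * B"
    using large mk by (intro mult_right_mono divide_left_mono) (auto simp: x_def B_def)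
  also have "\<dots> = \<delta> * real (Suc m choose Suc k) - real (m choose k)"
    using key mk by (simp add: field_simps)
  also have "\<dots> \<le> real (card E) - real (card (link v E))"
  proof -
    have "card (V - {v}) = m"
      using H m \<open>v \<in> V\<close> by (simp add: uniform_hypergraph_def)
    then have "card (link v E) \<le> m choose k"
      using card_uniform_hypergraph_le[OF uniform_hypergraph_link[OF H]] by metis
    then show ?thesis using dense by linarith
  qed
  also have "\<dots> = real (card (delete_vertex v E))"
    using card_link_plus_card_delete_vertex[OF uniform_hypergraph_finite_edges[OF H], of v] by linarith
  finally show ?thesis by (simp add: x_def B_def)
qed

section \<open>The container theorem\<close>

text \<open>
  In a \<open>1\<close>-uniform hypergraph the non-isolated vertices are the edges, and an independent set
  avoids them all. One container thus suffices.
\<close>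

lemma container_scheme_singletons:
  assumes "uniform_hypergraph 1 V E" and "\<delta> * real (card V) \<le> real (card E)"
  shows "container_scheme V (independent_sets V E) 0 ((1 - \<delta>) * real (card V))"
proof (rule container_scheme_single)
  have fin: "finite V" and edge: "\<And>e. e \<in> E \<Longrightarrow> e \<subseteq> V \<and> card e = 1"
    using assms by (auto simp: uniform_hypergraph_def)
  show "I \<subseteq> V - \<Union>E" if "I \<in> independent_sets V E" for I
  proof
    fix x assume "x \<in> I"
    have "x \<notin> e" if "e \<in> E" for e
    proof
      assume "x \<in> e"
      then have "e = {x}" using edge[OF that] by (auto simp: card_1_singleton_iff)
      then show False
        using that \<open>x \<in> I\<close> \<open>I \<in> independent_sets V E\<close> by (auto simp: independent_sets_def)
    qed
    then show "x \<in> V - \<Union>E"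
      using \<open>x \<in> I\<close> \<open>I \<in> independent_sets V E\<close> by (auto simp: independent_sets_def)
  qed
  have "E = (\<lambda>x. {x}) ` \<Union>E"
  proof (intro equalityI subsetI)
    fix e assume "e \<in> E"
    then obtain x where "e = {x}" using edge by (auto simp: card_1_singleton_iff)
    then show "e \<in> (\<lambda>x. {x}) ` \<Union>E" using \<open>e \<in> E\<close> by auto
  next
    fix e assume "e \<in> (\<lambda>x. {x}) ` \<Union>E"
    then obtain x e' where "e = {x}" "x \<in> e'" "e' \<in> E" by auto
    then show "e \<in> E" using edge[of e'] by (auto simp: card_1_singleton_iff)
  qed
  then have "card E = card (\<Union>E)"
    by (metis card_image inj_singleton inj_on_subset subset_UNIV)
  moreover have "\<Union>E \<subseteq> V" using edge by auto
  ultimately have "card (V - \<Union>E) = card V - card E" and "card E \<le> card V"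
    using fin by (auto simp: card_Diff_subset finite_subset card_mono)
  then show "real (card (V - \<Union>E)) \<le> (1 - \<delta>) * real (card V)"
    using assms(2) by (simp add: of_nat_diff algebra_simps)
qed auto

theorem container_scheme_independent_sets:
  fixes \<delta> :: real
  assumes "uniform_hypergraph (Suc k) V E" and "Suc k \<le> card V"
    and "\<delta> * real (card V choose Suc k) \<le> real (card E)"
  shows "container_scheme V (independent_sets V E) k ((1 - \<delta> / real (Suc k)) * real (card V))"
  using assms
proof (induction "card V" arbitrary: V E k \<delta>)
  case 0
  then show ?case by simp
next
  case (Suc m)
  note H = Suc.prems(1) and n = Suc.hyps(2)[symmetric]
  have fin: "finite V" using H by (simp add: uniform_hypergraph_def)
  have km: "k \<le> m" using Suc.prems(2) n by simp
  have dense: "\<delta> * real (Suc m choose Suc k) \<le> real (card E)"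
    using Suc.prems(3) n by simp
  let ?b = "(1 - \<delta> / real (Suc k)) * real (card V)"
  consider "\<delta> < 0" | "0 \<le> \<delta>" "k = 0" | j where "0 \<le> \<delta>" "k = Suc j"
    by (cases k) (auto simp: not_less[symmetric])
  then show ?case
  proof cases
    case 1
    show ?thesis
    proof (rule container_scheme_single[where A = V])
      have "1 \<le> 1 - \<delta> / real (Suc k)" using 1 by (simp add: field_simps)
      then show "real (card V) \<le> ?b"
        by (metis mult_right_mono mult_1 of_nat_0_le_iff)
    qed (auto simp: independent_sets_def)
  next
    case 2
    then show ?thesis
      using container_scheme_singletons[of V E \<delta>] H dense n by simp
  next
    case 3
    have "V \<noteq> {}" using n by auto
    then obtain v where v: "v \<in> V" and deg: "Suc k * card E \<le> card V * card (link v E)"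
      using exists_vertex_of_average_degree[OF H] by blast
    have m: "m = card (V - {v})" using v n fin by simp
    have b: "?b = real (Suc m) - \<delta> * real (Suc m) / real (Suc k)"
      by (simp add: n algebra_simps)
    have inn: "container_scheme (V - {v})
        ((\<lambda>I. I - {v}) ` {I \<in> independent_sets V E. v \<in> I}) j (?b - 1)"
    proof (rule container_scheme_mono[OF _ independent_sets_link])
      show "container_scheme (V - {v}) (independent_sets (V - {v}) (link v E)) j
          ((1 - \<delta> / real (Suc j)) * real (card (V - {v})))"
        using Suc.hyps(1)[OF m, of j "link v E" \<delta>] uniform_hypergraph_link[OF H, of v] km
          link_density[OF n deg dense] 3 m by simp
      have "real (Suc m) / real (Suc k) \<le> real m / real k"
        using km 3 by (simp add: field_simps)
      then have "\<delta> * (real (Suc m) / real (Suc k)) \<le> \<delta> * (real m / real k)"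
        using 3 by (intro mult_left_mono) auto
      then show "(1 - \<delta> / real (Suc j)) * real (card (V - {v})) \<le> ?b - 1"
        unfolding b m[symmetric] using 3 by (simp add: algebra_simps)
    qed
    have out: "container_scheme (V - {v}) {I \<in> independent_sets V E. v \<notin> I} k ?b"
    proof (cases "\<delta> * real (Suc m) \<le> real (Suc k)")
      case True
      show ?thesis
      proof (rule container_scheme_single[where A = "V - {v}"])
        have "\<delta> * real (Suc m) / real (Suc k) \<le> 1" using True by (simp add: field_simps)
        then show "real (card (V - {v})) \<le> ?b" unfolding b m[symmetric] by simp
      qed (auto simp: independent_sets_def)
    next
      case False
      \<comment> \<open>On \<open>s\<close> vertices the density is at most \<open>1\<close>, which contradicts \<open>\<delta> n > s\<close>.\<close>
      have "k < m"
      proof (rule ccontr)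
        assume "\<not> k < m"
        then have "k = m" using km by simp
        then have "\<delta> \<le> 1"
          using dense card_uniform_hypergraph_le[OF H] n by simp
        then have "\<delta> * real (Suc m) \<le> 1 * real (Suc m)" by (intro mult_right_mono) auto
        then show False using False \<open>k = m\<close> by simp
      qed
      define \<delta>' where "\<delta>' = (\<delta> * real (Suc m) - real (Suc k)) / real m"
      have "container_scheme (V - {v}) (independent_sets (V - {v}) (delete_vertex v E)) k
          ((1 - \<delta>' / real (Suc k)) * real (card (V - {v})))"
        using Suc.hyps(1)[OF m, of k "delete_vertex v E" \<delta>'] \<open>k < m\<close> False
          uniform_hypergraph_delete_vertex[OF H, of v]
          delete_vertex_density[OF H v n \<open>k < m\<close> dense]
        by (simp add: \<delta>'_def m[symmetric])
      moreover have "(1 - \<delta>' / real (Suc k)) * real (card (V - {v})) \<le> ?b"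
      proof -
        have "\<delta>' * real m = \<delta> * real (Suc m) - real (Suc k)"
          using \<open>k < m\<close> by (simp add: \<delta>'_def)
        then have "\<delta>' * real m / real (Suc k) = \<delta> * real (Suc m) / real (Suc k) - 1"
          by (simp only: diff_divide_distrib) simp
        then show ?thesis unfolding b m[symmetric] by (simp add: algebra_simps)
      qed
      ultimately show ?thesis
        by (rule container_scheme_mono[OF _ independent_sets_delete_vertex])
    qed
    show ?thesis
      using container_scheme_branch[OF fin v] inn out 3 by simp
  qed
qed

theorem theorem1p5:
  fixes V :: "'a set" and E :: "'a set set" and s n :: nat and \<delta> :: real
  assumes "uniform_hypergraph s V E"
    and "card V = n"
    and "1 \<le> s" and "s \<le> n"
    and "real (card E) \<ge> \<delta> * real (n choose s)"
  shows "\<exists>f C.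
    f \<in> independent_sets V E \<rightarrow> (\<Union>j\<in>{0..s - 1}. distinct_tuples V j) \<and>
    C \<in> f ` independent_sets V E \<rightarrow> subsets_of_size_le V ((1 - \<delta> / real s) * real n) \<and>
    (\<forall>I\<in>independent_sets V E. set (f I) \<subseteq> I \<and> I \<subseteq> C (f I))"
proof -
  have "Suc (s - 1) = s" using assms(3) by simp
  then have "container_scheme V (independent_sets V E) (s - 1) ((1 - \<delta> / real s) * real n)"
    using container_scheme_independent_sets[of "s - 1" V E \<delta>] assms by simp
  then obtain f C where fC: "\<forall>I\<in>independent_sets V E.
      distinct (f I) \<and> length (f I) \<le> s - 1 \<and> set (f I) \<subseteq> I \<and>
      I \<subseteq> C (f I) \<and> C (f I) \<subseteq> V \<and> real (card (C (f I))) \<le> (1 - \<delta> / real s) * real n"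
    unfolding container_scheme_def by (elim exE)
  have "f I \<in> (\<Union>j\<in>{0..s - 1}. distinct_tuples V j)" if "I \<in> independent_sets V E" for I
    using bspec[OF fC that] by (auto simp: distinct_tuples_def)
  then show ?thesis
    using fC by (intro exI[of _ f] exI[of _ C]) (auto simp: subsets_of_size_le_def)
qed

end
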